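(* Let $r\in(0,1)$ be a constant with the property stated in the context. Suppose that we have two matrices $$\begin{pmatrix}\alpha&\gamma\\ \beta&\delta\end{pmatrix},\qquad \begin{pmatrix}\xi_1&\xi_2\\ \eta_1&\eta_2\end{pmatrix}\in \mathrm{SL}_2(\mathbb{R}),$$ with $\delta\neq 0$ and $\beta/\delta\notin\mathbb{Q}$. Then there exist a sequence of reals $t_\nu\to\infty$ as $\nu\to\infty$ and a sequence of integer matrices $$L_\nu=\begin{pmatrix}l_1^1(\nu)&l_1^2(\nu)\\ l_2^1(\nu)&l_2^2(\nu)\end{pmatrix}\in\mathrm{SL}_2(\mathbb{Z})$$ such that $$\begin{pmatrix}1&t_\nu\\0&1\end{pmatrix}\begin{pmatrix}\alpha&\gamma\\ \beta&\delta\end{pmatrix}L_\nu-\begin{pmatrix}\xi_1&\xi_2\\ \eta_1&\eta_2\end{pmatrix}=O\!\left(|t_\nu|^{\frac{r-1}{r+1}}\right),$$ where the implied constant may depend on the sizes of the entries of the two given matrices.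
   Context: The constant $r\in(0,1)$ is assumed to have the following property: for every $\rho>0$, every (large) $Q$ and all reals $A_1,B_1$ with $A_1,B_1\asymp Q$ (i.e. comparable to $Q$ up to positive multiplicative constants), setting $A_2=-\rho A_1$, $B_2=-\rho B_1$, the equation $xy-zw=1$ has a solution $x,y,z,w\in\mathbb{Z}$ with $|x-A_1|\le Q^r$, $|z-B_1|\le Q^r$, $|y-A_2|\le Q^r$, $|w-B_2|\le Q^r$. (Such an $r$ does not depend on $\rho$.)
   Formalization: In the property of r, the equation xy−zw=1 is replaced by xw−yz=1 with the same windows, since as printed no r in (0,1) has the property (take A₁=Q, B₁=2Q, where xy−zw is about 3ρQ²). *)

theory Defs
  imports "HOL-Analysis.Analysis" "HOL-Library.Landau_Symbols"
begin

definition mat2 :: "'a::zero \<Rightarrow> 'a \<Rightarrow> 'a \<Rightarrow> 'a \<Rightarrow> 'a^2^2" where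
  "mat2 a b c d = vector [vector [a, b], vector [c, d]]"

definition SL2 :: "('a::comm_ring_1^2^2) set" where
  "SL2 = {A. det A = 1}"

definition real_mat :: "int^2^2 \<Rightarrow> real^2^2" where
  "real_mat L = (\<chi> i j. of_int (L $ i $ j))"

(* The condition A1, B1 \<asymp> Q is spelled out with arbitrary constants 0 < c1 \<le> c2; the
   threshold for Q may depend on \<rho>, c1, c2, whereas r may not.

   The equation is det (x, y; z, w) = 1, where (x, y; z, w) is close to the rank-one matrix
   (A1, A2; B1, B2).  The condition also appears in print as x y - z w = 1 with the same
   four windows, i.e. with the names y and w interchanged in the equation only.  Read
   literally, that condition holds for no r in (0,1), because the left-hand side would be close
   to \<rho> (B1^2 - A1^2); see the lemma literal_pairing_unsatisfiable below. *)
definition unimodular_exponent :: "real \<Rightarrow> bool" where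
  "unimodular_exponent r \<longleftrightarrow>
     (\<forall>\<rho>>0. \<forall>c1>0. \<forall>c2\<ge>c1. \<exists>Q0>0. \<forall>Q\<ge>Q0. \<forall>A1 B1 A2 B2 :: real.
        A1 \<in> {c1 * Q .. c2 * Q} \<longrightarrow> B1 \<in> {c1 * Q .. c2 * Q} \<longrightarrow>
        A2 = - \<rho> * A1 \<longrightarrow> B2 = - \<rho> * B1 \<longrightarrow>
        (\<exists>x y z w :: int. x * w - y * z = 1 \<and>
           \<bar>of_int x - A1\<bar> \<le> Q powr r \<and> \<bar>of_int z - B1\<bar> \<le> Q powr r \<and>
           \<bar>of_int y - A2\<bar> \<le> Q powr r \<and> \<bar>of_int w - B2\<bar> \<le> Q powr r))"

lemma literal_pairing_unsatisfiable:
  fixes r :: real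
  assumes "r < 1"
  shows "\<not> (\<forall>\<rho>>0. \<forall>c1>0. \<forall>c2\<ge>c1. \<exists>Q0>0. \<forall>Q\<ge>Q0. \<forall>A1 B1 A2 B2 :: real.
        A1 \<in> {c1 * Q .. c2 * Q} \<longrightarrow> B1 \<in> {c1 * Q .. c2 * Q} \<longrightarrow>
        A2 = - \<rho> * A1 \<longrightarrow> B2 = - \<rho> * B1 \<longrightarrow>
        (\<exists>x y z w :: int. x * y - z * w = 1 \<and>
           \<bar>of_int x - A1\<bar> \<le> Q powr r \<and> \<bar>of_int z - B1\<bar> \<le> Q powr r \<and>
           \<bar>of_int y - A2\<bar> \<le> Q powr r \<and> \<bar>of_int w - B2\<bar> \<le> Q powr r))"
    (is "\<not> ?P")
proof
  assume ?P
  from this[rule_format, of 1 1 2] obtain Q0 :: real where Q0: "Q0 > 0" and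
    H: "\<And>Q A1 B1 A2 B2. Q \<ge> Q0 \<Longrightarrow> A1 \<in> {Q .. 2 * Q} \<Longrightarrow> B1 \<in> {Q .. 2 * Q} \<Longrightarrow>
        A2 = - A1 \<Longrightarrow> B2 = - B1 \<Longrightarrow>
        \<exists>x y z w :: int. x * y - z * w = 1 \<and>
           \<bar>of_int x - A1\<bar> \<le> Q powr r \<and> \<bar>of_int z - B1\<bar> \<le> Q powr r \<and>
           \<bar>of_int y - A2\<bar> \<le> Q powr r \<and> \<bar>of_int w - B2\<bar> \<le> Q powr r"
    by auto
  have "((\<lambda>Q::real. Q powr (r - 1)) \<longlongrightarrow> 0) at_top"
    using assms by (intro tendsto_neg_powr filterlim_ident) auto
  then have "eventually (\<lambda>Q::real. Q powr (r - 1) < 1 / 4) at_top"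
    by (rule order_tendstoD) simp
  then have "eventually (\<lambda>Q::real. Q powr (r - 1) < 1 / 4 \<and> Q \<ge> Q0 \<and> Q \<ge> 2) at_top"
    by (intro eventually_conj eventually_ge_at_top) auto
  then obtain Q :: real where Q: "Q powr (r - 1) < 1 / 4" "Q \<ge> Q0" "Q \<ge> 2"
    by (auto simp: eventually_at_top_linorder)
  have "Q powr r = Q powr (r - 1) * Q"
    using Q by (simp add: powr_diff)
  also have "\<dots> \<le> 1 / 4 * Q"
    using Q by (intro mult_right_mono) auto
  finally have W: "Q powr r \<le> Q / 4" by simp
  obtain x y z w :: int where xyzw: "x * y - z * w = 1"
    "\<bar>of_int x - Q\<bar> \<le> Q powr r" "\<bar>of_int z - 2 * Q\<bar> \<le> Q powr r"
    "\<bar>of_int y + Q\<bar> \<le> Q powr r" "\<bar>of_int w + 2 * Q\<bar> \<le> Q powr r"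
    using H[of Q Q "2 * Q" "- Q" "- (2 * Q)"] Q by auto
  have "of_int x * (- of_int y) \<le> (5 / 4 * Q) * (5 / 4 * Q)"
    using xyzw W Q by (intro mult_mono) linarith+
  moreover have "(7 / 4 * Q) * (7 / 4 * Q) \<le> of_int z * (- of_int w)"
    using xyzw W Q by (intro mult_mono) linarith+
  moreover have "real_of_int x * of_int y - of_int z * of_int w = 1"
    using xyzw(1) by (metis of_int_1 of_int_diff of_int_mult)
  moreover have "2 * 2 \<le> Q * Q"
    using Q by (intro mult_mono) auto
  ultimately show False by simp
qed

end

(*
  Write M for the first matrix and X for the second. Multiplying X on the right by a matrix of
  SL_2(Z), we may assume eta1 > 0 > eta2. Good rational approximations to -beta/delta give
  P in SL_2(Z) with M P = (a, b; c, d), where a is large, -2a <= b <= -a and c, d = O(1/a).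
  Apply the hypothesis on r with Q = a and rho = -eta2/eta1 to the vector (A1, B1) which M P maps
  to (-4 a^(1+r), eta1). With the resulting N, the bottom row of M P N is within O(a^(r-1)) of
  (eta1, eta2), and its top left entry is negative of exact order a^(1+r). Choose t so that the top
  left entry becomes exactly xi1; then t is of order a^(1+r), so a^(r-1) is of order
  t^((r-1)/(r+1)), and the top right entry is forced by the determinant.
*)

theory Submission
  imports Defs
begin

section \<open>Two-by-two matrices, \<open>SL2\<close> and the embedding of integer matrices\<close>

lemma mat2_nth [simp]:
  "mat2 a b c d $ 1 $ 1 = a" "mat2 a b c d $ 1 $ 2 = b"
  "mat2 a b c d $ 2 $ 1 = c" "mat2 a b c d $ 2 $ 2 = d"
  by (simp_all add: mat2_def)

lemma mat2_eqI:
  fixes A :: "'a::zero^2^2"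
  shows "A $ 1 $ 1 = a \<Longrightarrow> A $ 1 $ 2 = b \<Longrightarrow> A $ 2 $ 1 = c \<Longrightarrow> A $ 2 $ 2 = d \<Longrightarrow> A = mat2 a b c d"
  by (simp add: vec_eq_iff forall_2)

lemma mat2_mult:
  fixes a b c d :: "'a::comm_ring_1"
  shows "mat2 a b c d ** mat2 e f g h
         = mat2 (a * e + b * g) (a * f + b * h) (c * e + d * g) (c * f + d * h)"
  by (intro mat2_eqI) (simp_all add: matrix_matrix_mult_def sum_2)

lemma mat2_diff:
  fixes a b c d :: "'a::comm_ring_1"
  shows "mat2 a b c d - mat2 e f g h = mat2 (a - e) (b - f) (c - g) (d - h)"
  by (intro mat2_eqI) simp_all

lemma det_mat2: "det (mat2 a b c d) = a * d - b * (c :: 'a::comm_ring_1)"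
  by (simp add: det_2 mat2_def)

lemma mat2_in_SL2_iff: "mat2 a b c d \<in> SL2 \<longleftrightarrow> a * d - b * (c :: 'a::comm_ring_1) = 1"
  by (simp add: SL2_def det_mat2)

lemma SL2_mult: "A \<in> SL2 \<Longrightarrow> B \<in> SL2 \<Longrightarrow> A ** B \<in> SL2"
  by (simp add: SL2_def det_mul)

lemma real_mat_mat2: "real_mat (mat2 a b c d) = mat2 (of_int a) (of_int b) (of_int c) (of_int d)"
  by (intro mat2_eqI) (simp_all add: real_mat_def)

lemma real_mat_mult: "real_mat (A ** B) = real_mat A ** real_mat B"
  by (simp add: real_mat_def matrix_matrix_mult_def vec_eq_iff)

lemma real_mat_in_SL2:
  assumes "A \<in> SL2"
  shows "real_mat A \<in> SL2"
proof -
  have "real_of_int (A$1$1 * A$2$2 - A$1$2 * A$2$1) = 1"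
    using assms by (simp add: SL2_def det_2)
  then show ?thesis
    by (simp add: SL2_def det_2 real_mat_def)
qed

lemma SL2_int_right_inverse:
  assumes "K \<in> (SL2 :: (int^2^2) set)"
  obtains K' where "K' \<in> SL2" "real_mat K ** real_mat K' = mat 1"
proof
  define K' where "K' = mat2 (K$2$2) (- K$1$2) (- K$2$1) (K$1$1)"
  have d: "K$1$1 * K$2$2 - K$1$2 * K$2$1 = 1"
    using assms by (simp add: SL2_def det_2)
  show "K' \<in> SL2"
    using d by (simp add: K'_def mat2_in_SL2_iff algebra_simps)
  have "K ** K' = mat 1"
    using d by (simp add: K'_def vec_eq_iff forall_2 matrix_matrix_mult_def sum_2 mat_def algebra_simps)
  moreover have "real_mat (mat 1) = mat 1"
    by (simp add: real_mat_def mat_def vec_eq_iff)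
  ultimately show "real_mat K ** real_mat K' = mat 1"
    by (metis real_mat_mult)
qed

lemma matrix_diff_mult: "(A - B) ** C = A ** C - B ** (C :: 'a::comm_ring_1^'n^'m)"
  by (simp add: vec_eq_iff matrix_matrix_mult_def left_diff_distrib sum_subtractf)

section \<open>The approximation property and normalization of the target\<close>

text \<open>\<open>C\<close> is quantified before \<open>R\<close>: arbitrarily large parameters
  \<open>t\<close> share one constant, which is what a big-O bound along a sequence
  requires.\<close>

definition horocycle_approx :: "real \<Rightarrow> real^2^2 \<Rightarrow> real^2^2 \<Rightarrow> bool" where
  "horocycle_approx e M X \<longleftrightarrow>
     (\<exists>C. \<forall>R. \<exists>t\<ge>R. \<exists>L\<in>SL2. \<forall>i j.
        \<bar>(mat2 1 t 0 1 ** M ** real_mat L - X) $ i $ j\<bar> \<le> C * \<bar>t\<bar> powr e)"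

text \<open>An error \<open>E\<close> against \<open>X ** real_mat K\<close> becomes
  \<open>E ** real_mat K'\<close> against \<open>X\<close>, where \<open>K'\<close> inverts
  \<open>K\<close>. This costs only a factor depending on the entries of \<open>K'\<close>, and
  \<open>L ** K'\<close> is still in \<open>SL2\<close>.\<close>

lemma horocycle_approx_cancel_right:
  assumes "horocycle_approx e M (X ** real_mat K)" "K \<in> SL2"
  shows "horocycle_approx e M X"
proof -
  obtain K' where K': "K' \<in> SL2" "real_mat K ** real_mat K' = mat 1"
    using SL2_int_right_inverse[OF assms(2)] .
  obtain C where C: "\<And>R. \<exists>t\<ge>R. \<exists>L\<in>SL2. \<forall>i j.
      \<bar>(mat2 1 t 0 1 ** M ** real_mat L - X ** real_mat K) $ i $ j\<bar> \<le> C * \<bar>t\<bar> powr e"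
    using assms(1) unfolding horocycle_approx_def by blast
  define D where "D = (\<Sum>k\<in>UNIV. \<Sum>j\<in>UNIV. \<bar>real_mat K' $ k $ j\<bar>)"
  have "\<exists>t\<ge>R. \<exists>L\<in>SL2. \<forall>i j.
      \<bar>(mat2 1 t 0 1 ** M ** real_mat L - X) $ i $ j\<bar> \<le> C * D * \<bar>t\<bar> powr e" for R
  proof -
    obtain t L where t: "t \<ge> R" and L: "L \<in> SL2" and
      b: "\<And>i j. \<bar>(mat2 1 t 0 1 ** M ** real_mat L - X ** real_mat K) $ i $ j\<bar> \<le> C * \<bar>t\<bar> powr e"
      using C by blast
    define E where "E = mat2 1 t 0 1 ** M ** real_mat L - X ** real_mat K"
    have eq: "mat2 1 t 0 1 ** M ** real_mat (L ** K') - X = E ** real_mat K'"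
    proof -
      have "E ** real_mat K' = mat2 1 t 0 1 ** M ** real_mat L ** real_mat K' - X ** real_mat K ** real_mat K'"
        by (simp only: E_def matrix_diff_mult)
      then show ?thesis
        by (simp only: real_mat_mult matrix_mul_assoc[symmetric] K'(2) matrix_mul_rid)
    qed
    have "\<bar>(E ** real_mat K') $ i $ j\<bar> \<le> C * D * \<bar>t\<bar> powr e" for i j
    proof -
      \<comment> \<open>The sign of \<open>C\<close> is not prescribed; nonnegativity of the bound
        follows because it dominates an absolute value.\<close>
      have C0: "0 \<le> C * \<bar>t\<bar> powr e"
        using b[of i j] by linarith
      have "\<bar>(E ** real_mat K') $ i $ j\<bar> \<le> (\<Sum>k\<in>UNIV. \<bar>E $ i $ k\<bar> * \<bar>real_mat K' $ k $ j\<bar>)"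
        unfolding matrix_matrix_mult_def by (simp flip: abs_mult)
      also have "\<dots> \<le> (\<Sum>k\<in>UNIV. (C * \<bar>t\<bar> powr e) * (\<Sum>j\<in>UNIV. \<bar>real_mat K' $ k $ j\<bar>))"
        using b C0 unfolding E_def
        by (intro sum_mono mult_mono member_le_sum) auto
      finally show ?thesis
        by (simp add: D_def sum_distrib_left mult_ac)
    qed
    then show ?thesis
      using t SL2_mult[OF L K'(1)] eq by metis
  qed
  then show ?thesis
    unfolding horocycle_approx_def by blast
qed

lemma horocycle_approx_sequence:
  assumes "horocycle_approx e M X"
  obtains t :: "nat \<Rightarrow> real" and L :: "nat \<Rightarrow> int^2^2"
  where "filterlim t at_top sequentially" "\<And>\<nu>. L \<nu> \<in> SL2"
    "\<And>i j. (\<lambda>\<nu>. (mat2 1 (t \<nu>) 0 1 ** M ** real_mat (L \<nu>) - X) $ i $ j) \<in> O(\<lambda>\<nu>. \<bar>t \<nu>\<bar> powr e)"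
proof -
  obtain C where C: "\<And>R. \<exists>t\<ge>R. \<exists>L\<in>SL2. \<forall>i j.
      \<bar>(mat2 1 t 0 1 ** M ** real_mat L - X) $ i $ j\<bar> \<le> C * \<bar>t\<bar> powr e"
    using assms unfolding horocycle_approx_def by blast
  \<comment> \<open>Taking \<open>R\<close> to be \<nu> forces \<open>t\<close> to diverge.\<close>
  then have "\<forall>\<nu>::nat. \<exists>t L. t \<ge> real \<nu> \<and> L \<in> SL2 \<and> (\<forall>i j.
      \<bar>(mat2 1 t 0 1 ** M ** real_mat L - X) $ i $ j\<bar> \<le> C * \<bar>t\<bar> powr e)"
    by blast
  then obtain t L where t: "\<And>\<nu>::nat. t \<nu> \<ge> real \<nu>" and L: "\<And>\<nu>::nat. L \<nu> \<in> SL2" and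
    b: "\<And>\<nu>::nat. \<And>i j. \<bar>(mat2 1 (t \<nu>) 0 1 ** M ** real_mat (L \<nu>) - X) $ i $ j\<bar> \<le> C * \<bar>t \<nu>\<bar> powr e"
    by metis
  show thesis
  proof (rule that)
    show "filterlim t at_top sequentially"
      by (rule filterlim_at_top_mono[OF filterlim_real_sequentially]) (use t in auto)
    show "(\<lambda>\<nu>. (mat2 1 (t \<nu>) 0 1 ** M ** real_mat (L \<nu>) - X) $ i $ j) \<in> O(\<lambda>\<nu>. \<bar>t \<nu>\<bar> powr e)" for i j
      by (rule bigoI[where c = C]) (use b in auto)
  qed (rule L)
qed

text \<open>
  Right multiplication by \<^term>\<open>mat2 0 (-1) 1 0\<close> permutes the four open quadrants cyclically, and a
  shear moves a bottom row lying on a coordinate axis into an open quadrant.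
\<close>
lemma bottom_row_quadrant:
  fixes \<xi>1 \<xi>2 \<eta>1 \<eta>2 :: real
  assumes "\<eta>1 \<noteq> 0 \<or> \<eta>2 \<noteq> 0"
  shows "\<exists>K\<in>SL2. (mat2 \<xi>1 \<xi>2 \<eta>1 \<eta>2 ** real_mat K) $ 2 $ 1 > 0 \<and>
    (mat2 \<xi>1 \<xi>2 \<eta>1 \<eta>2 ** real_mat K) $ 2 $ 2 < 0"
proof -
  have K: ?thesis if "k * n - l * m = 1" "\<eta>1 * k + \<eta>2 * m > 0" "\<eta>1 * l + \<eta>2 * n < 0" for k l m n :: int
    using that by (intro bexI[of _ "mat2 k l m n"])
      (auto simp: mat2_in_SL2_iff real_mat_mat2 mat2_mult)
  consider "\<eta>1 > 0" "\<eta>2 < 0" | "\<eta>1 > 0" "\<eta>2 > 0" | "\<eta>1 < 0" "\<eta>2 > 0" | "\<eta>1 < 0" "\<eta>2 < 0"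
    | "\<eta>1 > 0" "\<eta>2 = 0" | "\<eta>1 < 0" "\<eta>2 = 0" | "\<eta>1 = 0" "\<eta>2 > 0" | "\<eta>1 = 0" "\<eta>2 < 0"
    using assms by linarith
  then show ?thesis
  proof cases
    \<comment> \<open>The instances list \<open>k\<close>, \<open>n\<close>, \<open>l\<close>,
      \<open>m\<close> in this order, the diagonal first. Cases 1 to 4 use the powers of
      \<open>mat2 0 (-1) 1 0\<close>; cases 5 to 8 use these powers times the shear
      \<open>mat2 1 (-1) 0 1\<close>.\<close>
    case 1 then show ?thesis using K[of 1 1 0 0] by simp
  next
    case 2 then show ?thesis using K[of 0 0 "-1" 1] by simp
  next
    case 3 then show ?thesis using K[of "-1" "-1" 0 0] by simp
  next
    case 4 then show ?thesis using K[of 0 0 1 "-1"] by simp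
  next
    case 5 then show ?thesis using K[of 1 1 "-1" 0] by simp
  next
    case 6 then show ?thesis using K[of "-1" "-1" 1 0] by simp
  next
    case 7 then show ?thesis using K[of 0 "-1" "-1" 1] by simp
  next
    case 8 then show ?thesis using K[of 0 1 1 "-1"] by simp
  qed
qed

section \<open>Unimodular matrices from rational approximations\<close>

text \<open>The first column of \<open>P\<close> comes from a good approximation to
  -\<beta>/\<delta>, which makes \<open>c\<close> small and \<open>a\<close> large. The second
  column is free up to multiples of the first, which allows \<open>b\<close> to be placed between
  \<open>-2 * a\<close> and \<open>- a\<close>; the determinant then controls \<open>d\<close>. A
  negative \<open>b\<close> of order \<open>a\<close> later makes both \<open>A1\<close> and
  \<open>B1\<close> positive of order \<open>a\<close>.\<close>

lemma adapted_basis: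
  fixes \<alpha> \<beta> \<gamma> \<delta> R :: real
  assumes det: "\<alpha> * \<delta> - \<gamma> * \<beta> = 1" and "\<delta> \<noteq> 0" and irr: "\<beta> / \<delta> \<notin> \<rat>"
  obtains P a b c d where "P \<in> SL2" "mat2 \<alpha> \<gamma> \<beta> \<delta> ** real_mat P = mat2 a b c d"
    "a \<ge> R" "a > 0" "-2 * a \<le> b" "b \<le> - a" "\<bar>c\<bar> \<le> 5 / a" "\<bar>d\<bar> \<le> 5 / a"
proof -
  define \<theta> where "\<theta> = - \<beta> / \<delta>"
  have "\<theta> \<notin> \<rat>"
    using irr by (simp add: \<theta>_def)
  then have "infinite (approx_set \<theta>)"
    by (simp add: rational_iff_finite_approx_set)
  \<comment> \<open>In the lower bound for \<open>p0\<close>, the term with \<open>R\<close> yields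
    \<open>a \<ge> R\<close>, and the term with \<gamma> keeps \<open>\<gamma> * c0\<close> below
    \<open>p0 / 2\<close>.\<close>
  then obtain n0 p0 where np0: "(n0, p0) \<in> approx_set \<theta>" and
    p0_gt: "p0 > \<lceil>2 * \<bar>\<delta>\<bar> * \<bar>R\<bar> + 2 * \<bar>\<gamma>\<bar> * \<bar>\<delta>\<bar> + 2\<rceil>"
    using infinite_approx_set by meson
  then have p0: "real_of_int p0 > 2 * \<bar>\<delta>\<bar> * \<bar>R\<bar> + 2 * \<bar>\<gamma>\<bar> * \<bar>\<delta>\<bar> + 2"
    by linarith
  have cop: "coprime n0 p0" and p0_pos: "p0 > 0" and
    close: "\<bar>\<theta> - n0 / p0\<bar> < 1 / (real_of_int p0)\<^sup>2"
    using np0 by (auto simp: approx_set_def)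
  define a0 c0 where "a0 = \<alpha> * p0 + \<gamma> * n0" and "c0 = \<beta> * p0 + \<delta> * n0"
  have nonneg: "0 \<le> \<bar>\<delta>\<bar> * \<bar>R\<bar>" "0 \<le> \<bar>\<gamma>\<bar> * \<bar>\<delta>\<bar>"
    by auto
  have p0_ge1: "real_of_int p0 \<ge> 1"
    using p0_pos by linarith
  have "c0 = - (\<delta> * p0 * (\<theta> - n0 / p0))"
    using p0_pos \<open>\<delta> \<noteq> 0\<close> by (simp add: c0_def \<theta>_def field_simps)
  then have "\<bar>c0\<bar> = \<bar>\<delta>\<bar> * p0 * \<bar>\<theta> - n0 / p0\<bar>"
    using p0_pos by (simp add: abs_mult)
  also have "\<dots> \<le> \<bar>\<delta>\<bar> * p0 * (1 / (real_of_int p0)\<^sup>2)"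
    using close p0_pos by (intro mult_left_mono) auto
  also have "\<dots> = \<bar>\<delta>\<bar> / p0"
    using p0_pos by (simp add: power2_eq_square)
  finally have c0: "\<bar>c0\<bar> \<le> \<bar>\<delta>\<bar> / p0" .
  \<comment> \<open>The determinant eliminates \<open>n0\<close>, so the smallness of
    \<open>c0\<close> alone shows that \<open>\<delta> * a0\<close> is comparable to
    \<open>p0\<close>.\<close>
  have "\<delta> * a0 = (\<alpha> * \<delta> - \<gamma> * \<beta>) * p0 + \<gamma> * c0"
    by (simp add: a0_def c0_def algebra_simps)
  then have da0: "\<delta> * a0 = p0 + \<gamma> * c0"
    using det by simp
  have "\<bar>\<gamma> * c0\<bar> \<le> \<bar>\<gamma>\<bar> * (\<bar>\<delta>\<bar> / p0)"
    unfolding abs_mult by (intro mult_left_mono c0) auto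
  also have "\<dots> \<le> \<bar>\<gamma>\<bar> * \<bar>\<delta>\<bar>"
    using p0_ge1 divide_left_mono[of 1 "real_of_int p0" "\<bar>\<delta>\<bar>"] by (intro mult_left_mono) auto
  also have "\<dots> \<le> p0 / 2"
    using p0 nonneg by linarith
  finally have "\<bar>\<gamma> * c0\<bar> \<le> p0 / 2" .
  then have a0: "p0 / 2 \<le> \<bar>\<delta>\<bar> * \<bar>a0\<bar>" "\<bar>\<delta>\<bar> * \<bar>a0\<bar> \<le> 2 * p0"
    using da0 p0_pos unfolding abs_mult[symmetric] by linarith+
  \<comment> \<open>Negating the column if necessary makes \<open>a\<close> positive without
    changing the size of \<open>c\<close>.\<close>
  define p n where "p = (if a0 > 0 then p0 else - p0)" and "n = (if a0 > 0 then n0 else - n0)"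
  define a c where "a = \<alpha> * p + \<gamma> * n" and "c = \<beta> * p + \<delta> * n"
  have a_eq: "a = \<bar>a0\<bar>" and c_eq: "\<bar>c\<bar> = \<bar>c0\<bar>"
    by (auto simp: a_def c_def a0_def c0_def p_def n_def)
  have "\<bar>\<delta>\<bar> * \<bar>R\<bar> \<le> \<bar>\<delta>\<bar> * a"
    using a0(1) p0 nonneg unfolding a_eq by linarith
  then have aR: "a \<ge> R"
    using \<open>\<delta> \<noteq> 0\<close> by (simp add: mult_le_cancel_left)
  have a_pos: "a > 0"
    using a0(1) p0_pos unfolding a_eq by (cases "a0 = 0") auto
  have "\<bar>c\<bar> * a \<le> \<bar>\<delta>\<bar> / p0 * a"
    unfolding c_eq using c0 a_pos by (intro mult_right_mono) auto
  also have "\<dots> = (\<bar>\<delta>\<bar> * \<bar>a0\<bar>) / p0"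
    by (simp add: a_eq)
  also have "\<dots> \<le> 2"
    using a0(2) p0_pos by (simp add: field_simps)
  finally have c: "\<bar>c\<bar> * a \<le> 2" .
  have "coprime p n"
    using cop by (auto simp: p_def n_def coprime_commute)
  then obtain u v where uv: "u * p + v * n = 1"
    using bezout_int[of p n] by auto
  \<comment> \<open>The column \<open>(- v, u)\<close> completes \<open>(p, n)\<close> to
    determinant 1. Adding \<open>k\<close> times the first column shifts the top right entry by
    \<open>k * a\<close>; this \<open>k\<close> is the largest integer that leaves it at most
    \<open>- a\<close>.\<close>
  define k where "k = \<lfloor>(- a - (\<gamma> * u - \<alpha> * v)) / a\<rfloor>"
  define s m where "s = k * p - v" and "m = k * n + u"
  define b d where "b = \<alpha> * s + \<gamma> * m" and "d = \<beta> * s + \<delta> * m"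
  have P: "p * m - s * n = 1"
    using uv by (simp add: s_def m_def algebra_simps)
  have b_eq: "b = k * a + (\<gamma> * u - \<alpha> * v)"
    by (simp add: b_def a_def s_def m_def algebra_simps)
  have "k \<le> (- a - (\<gamma> * u - \<alpha> * v)) / a" "(- a - (\<gamma> * u - \<alpha> * v)) / a < k + 1"
    unfolding k_def by linarith+
  then have "k * a \<le> - a - (\<gamma> * u - \<alpha> * v)" "- a - (\<gamma> * u - \<alpha> * v) < (k + 1) * a"
    using a_pos by (simp_all add: field_simps)
  then have b: "-2 * a \<le> b" "b \<le> - a"
    by (simp_all add: b_eq algebra_simps)
  have "a * d - b * c = (\<alpha> * \<delta> - \<gamma> * \<beta>) * of_int (p * m - s * n)"
    by (simp add: a_def b_def c_def d_def algebra_simps)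
  then have abcd: "a * d - b * c = 1"
    using det P by simp
  \<comment> \<open>The constant 5 arises here: \<open>a * d = 1 + b * c\<close> with
    \<open>b * c\<close> at most 4 in size.\<close>
  have "\<bar>b * c\<bar> \<le> (2 * a) * \<bar>c\<bar>"
    unfolding abs_mult using b a_pos by (intro mult_right_mono) auto
  also have "\<dots> \<le> 4"
    using c by (simp add: mult.commute)
  finally have "\<bar>a * d\<bar> \<le> 5"
    using abcd by linarith
  then have "\<bar>d\<bar> * a \<le> 5"
    using a_pos by (simp add: abs_mult mult.commute)
  then have "\<bar>c\<bar> \<le> 5 / a" "\<bar>d\<bar> \<le> 5 / a"
    using c a_pos by (simp_all add: field_simps)
  moreover have "mat2 \<alpha> \<gamma> \<beta> \<delta> ** real_mat (mat2 p s n m) = mat2 a b c d"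
    by (simp add: real_mat_mat2 mat2_mult a_def b_def c_def d_def)
  ultimately show thesis
    using that[of "mat2 p s n m" a b c d] P aR a_pos b by (simp add: mat2_in_SL2_iff)
qed

section \<open>Applying the unimodular exponent\<close>

text \<open>Errors of size \<open>a powr r\<close> in the integer matrix are multiplied by
  \<open>c\<close> and \<open>d\<close>, both O(1/a), in the bottom row, and by \<open>a\<close> and
  \<open>b\<close> in the top row, where only the order of magnitude of the left entry matters.
  \<open>C\<close> depends neither on \<open>R\<close> nor on \<open>a\<close>, \<open>b\<close>,
  \<open>c\<close>, \<open>d\<close>; only the threshold for \<open>a\<close> depends on
  \<open>R\<close>.\<close>

lemma horocycle_approx_opposite_signs:
  fixes r \<xi>1 \<xi>2 \<eta>1 \<eta>2 :: real
  assumes r: "0 < r" "r < 1" "unimodular_exponent r"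
    and det: "\<xi>1 * \<eta>2 - \<xi>2 * \<eta>1 = 1" and \<eta>: "\<eta>1 > 0" "\<eta>2 < 0"
  obtains C where "\<And>R. \<exists>a0. \<forall>a\<ge>a0. \<forall>b c d. -2 * a \<le> b \<longrightarrow> b \<le> - a \<longrightarrow> \<bar>c\<bar> \<le> 5 / a \<longrightarrow> \<bar>d\<bar> \<le> 5 / a \<longrightarrow>
    a * d - b * c = 1 \<longrightarrow> (\<exists>t\<ge>R. \<exists>L\<in>SL2. \<forall>i j.
       \<bar>(mat2 1 t 0 1 ** mat2 a b c d ** real_mat L - mat2 \<xi>1 \<xi>2 \<eta>1 \<eta>2) $ i $ j\<bar> 
         \<le> C * \<bar>t\<bar> powr ((r - 1) / (r + 1)))"
proof -
  define e where "e = (r - 1) / (r + 1)"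
  have e: "e \<le> 0"
    using r by (simp add: e_def divide_nonpos_pos)
  \<comment> \<open>Positive by the opposite signs; the factor \<open>- \<rho>\<close> carries
    \<eta>1 to \<eta>2.\<close>
  define \<rho> where "\<rho> = - \<eta>2 / \<eta>1"
  \<comment> \<open>\<open>D\<close> bounds all entries by \<open>D * \<epsilon>\<close>: the
    fraction serves the top right entry, the summand 10 the bottom row. The extra factor in
    \<open>C\<close> converts \<epsilon> into a power of \<open>t\<close>, using
    \<open>t \<le> 16 / \<eta>1 * (a * h)\<close>.\<close>
  define D where "D = 20 * (\<bar>\<xi>1\<bar> * \<eta>1 + \<bar>1 - \<xi>1 * \<eta>2\<bar>) / \<eta>1\<^sup>2 + 10"
  define C where "C = D * (16 / \<eta>1) powr (- e)"
  have D: "D \<ge> 10"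
    using \<eta> by (simp add: D_def)
  have \<rho>: "\<rho> > 0"
    using \<eta> by (simp add: \<rho>_def divide_neg_pos)
  \<comment> \<open>The main terms of \<open>A1\<close> and \<open>B1\<close> lie between
    \<open>\<eta>1 * a\<close> and \<open>2 * \<eta>1 * a\<close>; the interval allows a deviation
    of \<open>\<eta>1 / 2 * a\<close> on either side.\<close>
  obtain Q0 where Q0: "\<forall>Q\<ge>Q0. \<forall>A1 B1. A1 \<in> {\<eta>1 / 2 * Q .. 5 / 2 * \<eta>1 * Q} \<longrightarrow>
        B1 \<in> {\<eta>1 / 2 * Q .. 5 / 2 * \<eta>1 * Q} \<longrightarrow>
        (\<exists>x y z w :: int. x * w - y * z = 1 \<and>
           \<bar>of_int x - A1\<bar> \<le> Q powr r \<and> \<bar>of_int z - B1\<bar> \<le> Q powr r \<and>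
           \<bar>of_int y - (- \<rho> * A1)\<bar> \<le> Q powr r \<and> \<bar>of_int w - (- \<rho> * B1)\<bar> \<le> Q powr r)"
    using r(3)[unfolded unimodular_exponent_def, rule_format, of \<rho> "\<eta>1 / 2" "5 / 2 * \<eta>1"] \<rho> \<eta>
    by auto
  \<comment> \<open>The bound \<open>\<eta>1 / 40\<close> makes both the deviation
    \<open>20 * \<epsilon> * a\<close> of \<open>A1\<close> and \<open>B1\<close> and the error
    \<open>10 * \<epsilon>\<close> of \<open>Y1\<close> harmless.\<close>
  have "((\<lambda>a::real. a powr (r - 1)) \<longlongrightarrow> 0) at_top"
    using r by (intro tendsto_neg_powr filterlim_ident) auto
  then have "eventually (\<lambda>a::real. a powr (r - 1) < \<eta>1 / 40) at_top"
    using \<eta> by (intro order_tendstoD) auto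
  then obtain a1 where a1: "\<And>a. a \<ge> a1 \<Longrightarrow> a powr (r - 1) < \<eta>1 / 40"
    by (auto simp: eventually_at_top_linorder)
  \<comment> \<open>The lower bound on \<open>a\<close> involving \<open>R\<close> ensures that the
    numerator of \<open>t\<close> dominates \<open>R * Y1\<close>.\<close>
  have main: "\<exists>t\<ge>R. \<exists>L\<in>SL2. \<forall>i j.
       \<bar>(mat2 1 t 0 1 ** mat2 a b c d ** real_mat L - mat2 \<xi>1 \<xi>2 \<eta>1 \<eta>2) $ i $ j\<bar> \<le> C * \<bar>t\<bar> powr e"
    if a: "a \<ge> a1" "a \<ge> Q0" "a \<ge> 1" "a \<ge> \<bar>\<xi>1\<bar> + 2 * \<eta>1 * \<bar>R\<bar> + 1"
      and b: "-2 * a \<le> b" "b \<le> - a" and cd: "\<bar>c\<bar> \<le> 5 / a" "\<bar>d\<bar> \<le> 5 / a"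
      and abcd: "a * d - b * c = 1" for R a b c d
  proof -
    define h where "h = a powr r"
    define \<epsilon> where "\<epsilon> = a powr (r - 1)"
    have h: "h \<ge> 1"
      using a r by (simp add: h_def ge_one_powr_ge_zero)
    have h_eq: "h = \<epsilon> * a"
      using a by (simp add: h_def \<epsilon>_def powr_diff)
    have \<epsilon>: "0 < \<epsilon>" "40 * \<epsilon> \<le> \<eta>1"
      using a1[OF a(1)] a by (auto simp: \<epsilon>_def)
    \<comment> \<open>\<open>X1\<close> will differ from \<tau> by at most
      \<open>a * h + 2 * a * h\<close>; the factor 4 therefore keeps \<open>X1\<close> negative of
      exact order \<open>a * h\<close>.\<close>
    define \<tau> where "\<tau> = - 4 * a * h"
    \<comment> \<open>The inverse of \<open>mat2 a b c d\<close> applied to the column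
      \<open>(\<tau>, \<eta>1)\<close>.\<close>
    define A1 B1 where "A1 = d * \<tau> - b * \<eta>1" and "B1 = - c * \<tau> + a * \<eta>1"
    have small: "\<bar>u * v\<bar> \<le> 5 * \<epsilon>" if "\<bar>u\<bar> \<le> 5 / a" "\<bar>v\<bar> \<le> h" for u v
    proof -
      have "\<bar>u * v\<bar> \<le> 5 / a * h"
        unfolding abs_mult using that a by (intro mult_mono) auto
      then show ?thesis
        using a by (simp add: h_eq)
    qed
    have tau_small: "\<bar>u * \<tau>\<bar> \<le> \<eta>1 / 2 * a" if "\<bar>u\<bar> \<le> 5 / a" for u
    proof -
      have "\<bar>u * \<tau>\<bar> = \<bar>u * h\<bar> * (4 * a)"
        using a by (simp add: \<tau>_def abs_mult)
      also have "\<dots> \<le> (5 * \<epsilon>) * (4 * a)"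
        using small[OF that, of h] h a by (intro mult_right_mono) auto
      also have "\<dots> = (20 * \<epsilon>) * a"
        by simp
      also have "\<dots> \<le> \<eta>1 / 2 * a"
        using \<epsilon> a by (intro mult_right_mono) auto
      finally show ?thesis .
    qed
    have "a * \<eta>1 \<le> - b * \<eta>1" "- b * \<eta>1 \<le> 2 * a * \<eta>1"
      using b \<eta> by (intro mult_right_mono; simp)+
    then have A1: "A1 \<in> {\<eta>1 / 2 * a .. 5 / 2 * \<eta>1 * a}"
      using tau_small[OF cd(2)] unfolding A1_def atLeastAtMost_iff abs_le_iff
      by (simp add: algebra_simps)
    have "a * \<eta>1 > 0"
      using a \<eta> by auto
    then have B1: "B1 \<in> {\<eta>1 / 2 * a .. 5 / 2 * \<eta>1 * a}"
      using tau_small[OF cd(1)] by (auto simp: B1_def abs_le_iff mult.commute)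
    obtain x y z w :: int where xw: "x * w - y * z = 1" and near: "\<bar>x - A1\<bar> \<le> h" "\<bar>z - B1\<bar> \<le> h"
      "\<bar>y - (- \<rho> * A1)\<bar> \<le> h" "\<bar>w - (- \<rho> * B1)\<bar> \<le> h"
      using Q0[rule_format, OF a(2) A1 B1] unfolding h_def by blast
    have cA: "c * A1 + d * B1 = (a * d - b * c) * \<eta>1" and aA: "a * A1 + b * B1 = (a * d - b * c) * \<tau>"
      by (simp_all add: A1_def B1_def algebra_simps)
    define X1 X2 Y1 Y2 where "X1 = a * x + b * z" and "X2 = a * y + b * w"
      and "Y1 = c * x + d * z" and "Y2 = c * y + d * w"
    have "X1 * Y2 - X2 * Y1 = (a * d - b * c) * of_int (x * w - y * z)"
      by (simp add: X1_def X2_def Y1_def Y2_def algebra_simps)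
    then have XY: "X1 * Y2 - X2 * Y1 = 1"
      using abcd xw by simp
    have "Y1 - \<eta>1 = c * (x - A1) + d * (z - B1)"
      using cA abcd by (simp add: Y1_def algebra_simps)
    then have Y1: "\<bar>Y1 - \<eta>1\<bar> \<le> 10 * \<epsilon>"
      using small[OF cd(1) near(1)] small[OF cd(2) near(2)] by linarith
    have "- \<rho> * (c * A1 + d * B1) = \<eta>2"
      using cA abcd \<eta> by (simp add: \<rho>_def)
    then have "Y2 - \<eta>2 = c * (y - (- \<rho> * A1)) + d * (w - (- \<rho> * B1))"
      by (simp add: Y2_def algebra_simps)
    then have Y2: "\<bar>Y2 - \<eta>2\<bar> \<le> 10 * \<epsilon>"
      using small[OF cd(1) near(3)] small[OF cd(2) near(4)] by linarith
    have "X1 - \<tau> = a * (x - A1) + b * (z - B1)"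
      using aA abcd by (simp add: X1_def algebra_simps)
    moreover have "\<bar>a * (x - A1)\<bar> \<le> a * h"
      unfolding abs_mult using a near by (intro mult_mono) auto
    moreover have "\<bar>b * (z - B1)\<bar> \<le> (2 * a) * h"
      unfolding abs_mult using a b near by (intro mult_mono) auto
    ultimately have X1: "- 7 * (a * h) \<le> X1" "X1 \<le> - (a * h)"
      unfolding \<tau>_def by linarith+
    have Y1_bounds: "\<eta>1 / 2 \<le> Y1" "Y1 \<le> 2 * \<eta>1" "Y1 > 0"
      using Y1 \<epsilon> \<eta> by linarith+
    have "a \<le> a * h"
      using a h by simp
    define t where "t = (\<xi>1 - X1) / Y1"
    have "R * Y1 \<le> \<bar>R\<bar> * (2 * \<eta>1)"
      using Y1_bounds by (intro mult_mono) auto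
    then have "R * Y1 \<le> 2 * \<eta>1 * \<bar>R\<bar>"
      by (simp add: mult_ac)
    then have "R * Y1 \<le> \<xi>1 - X1"
      using a X1 \<open>a \<le> a * h\<close> by linarith
    then have "t \<ge> R"
      using Y1_bounds by (simp add: t_def pos_le_divide_eq)
    have nonneg: "0 \<le> \<eta>1 * \<bar>R\<bar>"
      using \<eta> by simp
    have "\<xi>1 - X1 > 0"
      using a X1 \<open>a \<le> a * h\<close> nonneg by linarith
    then have "t > 0"
      using Y1_bounds by (simp add: t_def)
    have "\<xi>1 - X1 \<le> 8 * (a * h)"
      using a X1 \<open>a \<le> a * h\<close> nonneg by linarith
    then have "t \<le> 8 * (a * h) / (\<eta>1 / 2)"
      unfolding t_def using Y1_bounds \<eta> a h \<open>\<xi>1 - X1 > 0\<close>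
      by (intro frac_le) auto
    then have t_le: "t \<le> 16 / \<eta>1 * (a * h)"
      by simp
    \<comment> \<open>The exponent \<open>e\<close> is the one for which \<epsilon> equals
      \<open>(a * h) powr e\<close>. Since \<open>e \<le> 0\<close>, an upper bound on
      \<open>t\<close> suffices to bound \<epsilon> by a multiple of
      \<open>t powr e\<close>.\<close>
    have "a * h = a powr (1 + r)"
      using a by (simp add: h_def powr_add)
    moreover have "(1 + r) * e = r - 1"
      using r by (simp add: e_def field_simps)
    ultimately have "\<epsilon> = (a * h) powr e"
      by (simp add: \<epsilon>_def powr_powr)
    also have "(a * h) powr e = (16 / \<eta>1) powr (- e) * (16 / \<eta>1 * (a * h)) powr e"
      using a h \<eta> powr_mult[of "16 / \<eta>1" "a * h" e] by (simp add: powr_minus)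
    also have "\<dots> \<le> (16 / \<eta>1) powr (- e) * t powr e"
      using t_le \<open>t > 0\<close> e by (intro mult_left_mono powr_mono2') auto
    finally have \<epsilon>_le: "D * \<epsilon> \<le> C * \<bar>t\<bar> powr e"
      using D \<open>t > 0\<close> by (simp add: C_def mult.assoc)
    have "X1 + t * Y1 = \<xi>1"
      using Y1_bounds by (simp add: t_def)
    \<comment> \<open>The shear preserves the determinant, so the top right entry is determined by
      the other three; no estimate of the large terms \<open>X2\<close> and \<open>t * Y2\<close> is
      needed.\<close>
    have "(X2 + t * Y2) * Y1 = (X1 + t * Y1) * Y2 - 1"
      using XY by (simp add: algebra_simps)
    then have row1: "(X2 + t * Y2) * Y1 = \<xi>1 * Y2 - 1"
      using \<open>X1 + t * Y1 = \<xi>1\<close> by simp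
    \<comment> \<open>Clearing the denominators \<open>Y1\<close> and \<eta>1 in the two determinant
      formulas turns the error into a linear combination of the bottom row errors.\<close>
    have "(X2 + t * Y2 - \<xi>2) * (Y1 * \<eta>1) = ((X2 + t * Y2) * Y1) * \<eta>1 - (\<xi>2 * \<eta>1) * Y1"
      by (simp add: algebra_simps)
    also have "\<dots> = (\<xi>1 * Y2 - 1) * \<eta>1 - (\<xi>1 * \<eta>2 - 1) * Y1"
      using row1 det by (simp add: diff_eq_eq)
    also have "\<dots> = (\<xi>1 * \<eta>1) * (Y2 - \<eta>2) + (1 - \<xi>1 * \<eta>2) * (Y1 - \<eta>1)"
      by (simp add: algebra_simps)
    also have "\<bar>\<dots>\<bar> \<le> (\<bar>\<xi>1\<bar> * \<eta>1) * (10 * \<epsilon>) + \<bar>1 - \<xi>1 * \<eta>2\<bar> * (10 * \<epsilon>)"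
      using \<eta> Y1 Y2 by (intro order_trans[OF abs_triangle_ineq] add_mono)
        (auto simp: abs_mult intro!: mult_mono)
    also have "\<dots> = (D - 10) * \<epsilon> * (\<eta>1 / 2 * \<eta>1)"
      using \<eta> by (simp add: D_def field_simps power2_eq_square)
    also have "\<dots> \<le> D * \<epsilon> * (Y1 * \<eta>1)"
      using Y1_bounds \<eta> D \<epsilon> by (intro mult_mono) auto
    finally have "\<bar>X2 + t * Y2 - \<xi>2\<bar> * (Y1 * \<eta>1) \<le> D * \<epsilon> * (Y1 * \<eta>1)"
      using Y1_bounds \<eta> by (simp add: abs_mult)
    then have "\<bar>X2 + t * Y2 - \<xi>2\<bar> \<le> D * \<epsilon>"
      using Y1_bounds \<eta> by (simp add: mult_le_cancel_right)
    then have X2: "\<bar>X2 + t * Y2 - \<xi>2\<bar> \<le> C * \<bar>t\<bar> powr e"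
      using \<epsilon>_le by linarith
    have "10 * \<epsilon> \<le> D * \<epsilon>"
      using D \<epsilon> by (intro mult_right_mono) auto
    then have Y: "\<bar>Y1 - \<eta>1\<bar> \<le> C * \<bar>t\<bar> powr e" "\<bar>Y2 - \<eta>2\<bar> \<le> C * \<bar>t\<bar> powr e"
      using Y1 Y2 \<epsilon>_le by linarith+
    then have "0 \<le> C * \<bar>t\<bar> powr e"
      by linarith
    moreover have "mat2 1 t 0 1 ** mat2 a b c d ** real_mat (mat2 x y z w) - mat2 \<xi>1 \<xi>2 \<eta>1 \<eta>2
        = mat2 (X1 + t * Y1 - \<xi>1) (X2 + t * Y2 - \<xi>2) (Y1 - \<eta>1) (Y2 - \<eta>2)"
      by (simp add: real_mat_mat2 mat2_mult mat2_diff X1_def X2_def Y1_def Y2_def algebra_simps)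
    ultimately have "\<forall>i j. \<bar>(mat2 1 t 0 1 ** mat2 a b c d ** real_mat (mat2 x y z w)
        - mat2 \<xi>1 \<xi>2 \<eta>1 \<eta>2) $ i $ j\<bar> \<le> C * \<bar>t\<bar> powr e"
      using X2 Y \<open>X1 + t * Y1 = \<xi>1\<close> by (simp add: forall_2)
    then show ?thesis
      using \<open>t \<ge> R\<close> xw by (meson mat2_in_SL2_iff)
  qed
  show thesis
  proof (rule that[of C])
    show "\<exists>a0. \<forall>a\<ge>a0. \<forall>b c d. -2 * a \<le> b \<longrightarrow> b \<le> - a \<longrightarrow> \<bar>c\<bar> \<le> 5 / a \<longrightarrow> \<bar>d\<bar> \<le> 5 / a \<longrightarrow>
      a * d - b * c = 1 \<longrightarrow> (\<exists>t\<ge>R. \<exists>L\<in>SL2. \<forall>i j.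
         \<bar>(mat2 1 t 0 1 ** mat2 a b c d ** real_mat L - mat2 \<xi>1 \<xi>2 \<eta>1 \<eta>2) $ i $ j\<bar>
           \<le> C * \<bar>t\<bar> powr ((r - 1) / (r + 1)))" for R
      by (rule exI[of _ "Max {a1, Q0, 1, \<bar>\<xi>1\<bar> + 2 * \<eta>1 * \<bar>R\<bar> + 1}"], intro allI impI,
          rule main[unfolded e_def]) simp_all
  qed
qed

section \<open>Assembling the approximating sequence\<close>

theorem theorem1:
  fixes r \<alpha> \<beta> \<gamma> \<delta> \<xi>1 \<xi>2 \<eta>1 \<eta>2 :: real
  assumes "0 < r" and "r < 1" and "unimodular_exponent r"
    and "mat2 \<alpha> \<gamma> \<beta> \<delta> \<in> SL2"
    and "mat2 \<xi>1 \<xi>2 \<eta>1 \<eta>2 \<in> SL2"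
    and "\<delta> \<noteq> 0" and "\<beta> / \<delta> \<notin> \<rat>"
  shows "\<exists>(t :: nat \<Rightarrow> real) (L :: nat \<Rightarrow> int^2^2).
           filterlim t at_top sequentially \<and>
           (\<forall>\<nu>. L \<nu> \<in> SL2) \<and>
           (\<forall>i j. (\<lambda>\<nu>. (mat2 1 (t \<nu>) 0 1 ** mat2 \<alpha> \<gamma> \<beta> \<delta> ** real_mat (L \<nu>)
                         - mat2 \<xi>1 \<xi>2 \<eta>1 \<eta>2) $ i $ j)
                     \<in> O(\<lambda>\<nu>. \<bar>t \<nu>\<bar> powr ((r - 1) / (r + 1))))"
proof -
  let ?M = "mat2 \<alpha> \<gamma> \<beta> \<delta>" and ?X = "mat2 \<xi>1 \<xi>2 \<eta>1 \<eta>2" and ?e = "(r - 1) / (r + 1)"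
  have "\<eta>1 \<noteq> 0 \<or> \<eta>2 \<noteq> 0"
    using assms(5) by (auto simp: mat2_in_SL2_iff)
  then obtain K where K: "K \<in> SL2" "(?X ** real_mat K) $ 2 $ 1 > 0" "(?X ** real_mat K) $ 2 $ 2 < 0"
    using bottom_row_quadrant by blast
  define x1 x2 y1 y2 where "x1 = (?X ** real_mat K) $ 1 $ 1" and "x2 = (?X ** real_mat K) $ 1 $ 2"
    and "y1 = (?X ** real_mat K) $ 2 $ 1" and "y2 = (?X ** real_mat K) $ 2 $ 2"
  have XK: "?X ** real_mat K = mat2 x1 x2 y1 y2"
    by (rule mat2_eqI) (simp_all add: x1_def x2_def y1_def y2_def)
  then have "x1 * y2 - x2 * y1 = 1"
    using SL2_mult[OF assms(5) real_mat_in_SL2[OF K(1)]] by (simp add: mat2_in_SL2_iff)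
  from horocycle_approx_opposite_signs[OF assms(1-3) this] K(2,3)
  obtain C where C: "\<And>R. \<exists>a0. \<forall>a\<ge>a0. \<forall>b c d. -2 * a \<le> b \<longrightarrow> b \<le> - a \<longrightarrow>
    \<bar>c\<bar> \<le> 5 / a \<longrightarrow> \<bar>d\<bar> \<le> 5 / a \<longrightarrow> a * d - b * c = 1 \<longrightarrow> (\<exists>t\<ge>R. \<exists>L\<in>SL2. \<forall>i j.
       \<bar>(mat2 1 t 0 1 ** mat2 a b c d ** real_mat L - mat2 x1 x2 y1 y2) $ i $ j\<bar> \<le> C * \<bar>t\<bar> powr ?e)"
    unfolding y1_def y2_def by blast
  \<comment> \<open>With \<open>C\<close> fixed, \<open>R\<close> determines the threshold
    \<open>a0\<close>, and only then is \<open>P\<close> chosen with \<open>a \<ge> a0\<close>. The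
    required integer matrix is \<open>P ** L\<close>.\<close>
  have "\<exists>t\<ge>R. \<exists>L\<in>SL2. \<forall>i j.
     \<bar>(mat2 1 t 0 1 ** ?M ** real_mat L - mat2 x1 x2 y1 y2) $ i $ j\<bar> \<le> C * \<bar>t\<bar> powr ?e" for R
  proof -
    obtain a0 where a0: "\<And>a b c d. a \<ge> a0 \<Longrightarrow> -2 * a \<le> b \<Longrightarrow> b \<le> - a \<Longrightarrow>
      \<bar>c\<bar> \<le> 5 / a \<Longrightarrow> \<bar>d\<bar> \<le> 5 / a \<Longrightarrow> a * d - b * c = 1 \<Longrightarrow> (\<exists>t\<ge>R. \<exists>L\<in>SL2. \<forall>i j.
       \<bar>(mat2 1 t 0 1 ** mat2 a b c d ** real_mat L - mat2 x1 x2 y1 y2) $ i $ j\<bar> \<le> C * \<bar>t\<bar> powr ?e)"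
      using C[of R] by blast
    have "\<alpha> * \<delta> - \<gamma> * \<beta> = 1"
      using assms(4) by (simp add: mat2_in_SL2_iff)
    then obtain P a b c d where P: "P \<in> SL2" "?M ** real_mat P = mat2 a b c d"
      and abcd: "a \<ge> a0" "-2 * a \<le> b" "b \<le> - a" "\<bar>c\<bar> \<le> 5 / a" "\<bar>d\<bar> \<le> 5 / a"
      using adapted_basis[OF _ assms(6,7)] by metis
    have "a * d - b * c = 1"
      using SL2_mult[OF assms(4) real_mat_in_SL2[OF P(1)]] P(2) by (simp add: mat2_in_SL2_iff)
    from a0[OF abcd this] obtain t L where tL: "t \<ge> R" "L \<in> SL2"
      "\<forall>i j. \<bar>(mat2 1 t 0 1 ** mat2 a b c d ** real_mat L - mat2 x1 x2 y1 y2) $ i $ j\<bar> \<le> C * \<bar>t\<bar> powr ?e"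
      by blast
    have "mat2 1 t 0 1 ** ?M ** real_mat (P ** L) = mat2 1 t 0 1 ** mat2 a b c d ** real_mat L"
      by (simp add: real_mat_mult matrix_mul_assoc flip: P(2))
    then show ?thesis
      using tL SL2_mult[OF P(1) tL(2)] by metis
  qed
  then have "horocycle_approx ?e ?M (?X ** real_mat K)"
    unfolding horocycle_approx_def XK by blast
  then have "horocycle_approx ?e ?M ?X"
    using K(1) by (rule horocycle_approx_cancel_right)
  then show ?thesis
    by (rule horocycle_approx_sequence) blast
qed

end
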